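(* Let $f:\mathbb R^d\to\mathbb R$ be a standard self-concordant function, and suppose there are constants $L\ge\lambda>0$ with $\lambda I\preceq f''(w)\preceq LI$ for all $w\in\mathbb R^d$. Let $w_\star$ be the minimizer of $f$. Let $\{w_k\}_{k\ge0}$ be generated by the inexact damped Newton method (see context) from $w_0\in\mathbb R^d$ with tolerances $\epsilon_k=\beta(\lambda/L)^{1/2}\|f'(w_k)\|_2$, $\beta=1/20$. Then for any $\epsilon>0$, we have $f(w_k)-f(w_\star)\le\epsilon$ whenever $k\ge K$, where $$K=\left\lceil\frac{f(w_0)-f(w_\star)}{\frac12\omega(1/6)}\right\rceil+\left\lceil\log_2\Bigl(\frac{2\,\omega(1/6)}{\epsilon}\Bigr)\right\rceil,\qquad \omega(t)=t-\log(1+t),$$ and $\lceil t\rceil$ denotes the smallest nonnegative integer that is larger than or equal to $t$.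
   Context: A convex function $f:\mathbb R^d\to\mathbb R$ with continuous third derivatives is standard self-concordant if $|u^T(f'''(w)[u])u|\le 2(u^Tf''(w)u)^{3/2}$ for all $w,u\in\mathbb R^d$, where $f'''(w)[u]=\lim_{t\to0}\frac1t(f''(w+tu)-f''(w))$. Inexact damped Newton method: given $w_0$ and a nonnegative sequence $\{\epsilon_k\}$, for $k=0,1,2,\dots$: (1) find any vector $v_k$ such that $\|f''(w_k)v_k-f'(w_k)\|_2\le\epsilon_k$; (2) compute $\delta_k=\sqrt{v_k^Tf''(w_k)v_k}$ and set $w_{k+1}=w_k-\frac{1}{1+\delta_k}v_k$. *)

theory Defs
  imports "HOL-Analysis.Analysis"
begin

definition grad :: "(real ^ 'd \<Rightarrow> real) \<Rightarrow> real ^ 'd \<Rightarrow> real ^ 'd" where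
  "grad f w = (THE g. GDERIV f w :> g)"

definition hessian :: "(real ^ 'd \<Rightarrow> real) \<Rightarrow> real ^ 'd \<Rightarrow> real ^ 'd ^ 'd" where
  "hessian f w = jacobian (grad f) (at w)"

definition third_deriv ::
    "(real ^ 'd \<Rightarrow> real) \<Rightarrow> real ^ 'd \<Rightarrow> real ^ 'd \<Rightarrow> real ^ 'd ^ 'd" where
  "third_deriv f w u =
     Lim (at 0) (\<lambda>t. (1 / t) *\<^sub>R (hessian f (w + t *\<^sub>R u) - hessian f w))"

(* Continuity of w \<mapsto> third_deriv f w u for every direction u amounts, in finite
   dimension, to continuity of the derivative of the Hessian, i.e. f is of class C^3.
   The differentiability conditions make the total functions grad, hessian and
   third_deriv denote the actual derivatives at every point. *)
definition C3 :: "(real ^ 'd \<Rightarrow> real) \<Rightarrow> bool" where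
  "C3 f \<longleftrightarrow>
     (\<forall>w. f differentiable (at w)) \<and>
     (\<forall>w. grad f differentiable (at w)) \<and>
     (\<forall>w. hessian f differentiable (at w)) \<and>
     (\<forall>u. continuous_on UNIV (\<lambda>w. third_deriv f w u))"

(* The base of the power is nonnegative by convexity, so powr is the usual power
   (with 0 powr (3/2) = 0). *)
definition standard_self_concordant :: "(real ^ 'd \<Rightarrow> real) \<Rightarrow> bool" where
  "standard_self_concordant f \<longleftrightarrow>
     convex_on UNIV f \<and> C3 f \<and>
     (\<forall>w u. \<bar>u \<bullet> (third_deriv f w u *v u)\<bar> \<le> 2 * (u \<bullet> (hessian f w *v u)) powr (3 / 2))"

(* Loewner order. Symmetry of B - A is not part of the definition; it is applied below
   to Hessians of C^3 functions and multiples of the identity, which are symmetric. *)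
definition loewner_le :: "real ^ 'd ^ 'd \<Rightarrow> real ^ 'd ^ 'd \<Rightarrow> bool" where
  "loewner_le A B \<longleftrightarrow> (\<forall>u. 0 \<le> u \<bullet> ((B - A) *v u))"

(* The existential witness v is the sequence of inexact Newton directions: any choice
   meeting the residual tolerance is allowed. *)
definition inexact_damped_newton ::
    "(real ^ 'd \<Rightarrow> real) \<Rightarrow> (nat \<Rightarrow> real) \<Rightarrow> (nat \<Rightarrow> real ^ 'd) \<Rightarrow> bool" where
  "inexact_damped_newton f \<epsilon> w \<longleftrightarrow>
     (\<forall>k. 0 \<le> \<epsilon> k) \<and>
     (\<exists>v. \<forall>k.
        norm (hessian f (w k) *v v k - grad f (w k)) \<le> \<epsilon> k \<and>
        (let \<delta> = sqrt (v k \<bullet> (hessian f (w k) *v v k))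
         in w (Suc k) = w k - (1 / (1 + \<delta>)) *\<^sub>R v k))"

definition \<omega> :: "real \<Rightarrow> real" where
  "\<omega> t = t - ln (1 + t)"

definition nonneg_ceiling :: "real \<Rightarrow> nat" where
  "nonneg_ceiling t = (LEAST n. t \<le> real n)"

lemma nonneg_ceiling_eq: "nonneg_ceiling t = nat \<lceil>t\<rceil>"
  unfolding nonneg_ceiling_def
  by (rule Least_equality) (auto simp: real_nat_ceiling_ge nat_le_iff ceiling_le_iff)

end

theory Submission imports Defs begin

text \<open>
  Write \<open>g\<^sub>k = f(w\<^sub>k) - f(w\<^sub>\<star>)\<close> and \<open>\<omega>\<^sub>*(t) = - t - ln (1 - t)\<close>. The tolerance gives
  \<open>\<bar>h \<bullet> (f''(w\<^sub>k) v\<^sub>k - f'(w\<^sub>k))\<bar> \<le> \<delta>\<^sub>k \<parallel>h\<parallel> / 19\<close> in the local norm at \<open>w\<^sub>k\<close>, so self-concordance along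
  single lines already yields \<open>g\<^sub>k\<^sub>+\<^sub>1 \<le> g\<^sub>k - D(\<delta>\<^sub>k)\<close> with \<open>D(\<delta>) = \<omega>(\<delta>) - \<delta>\<^sup>2 / (19 (1 + \<delta>))\<close>, and
  \<open>g\<^sub>k \<le> \<omega>\<^sub>*(20 \<delta>\<^sub>k / 19)\<close>. If \<open>\<delta>\<^sub>k \<le> 1/6\<close>, then \<open>D(\<delta>\<^sub>k) \<ge> \<omega>\<^sub>*(20 \<delta>\<^sub>k / 19) / 2\<close>, so the gap halves;
  otherwise it drops by at least \<open>\<omega>(1/6) / 2\<close>. Contracting the gap itself rather than the Newton
  decrement avoids comparing Hessians at consecutive iterates, hence the trilinear form of
  self-concordance.
\<close>

subsection \<open>Self-concordant functions of one variable\<close>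

lemma powr_three_halves_sqrt:
  fixes x :: real
  assumes "x > 0"
  shows "x powr (3 / 2) = sqrt x ^ 3"
proof -
  have "x powr (3/2) = x powr (1 + 1/2)" by simp
  also have "\<dots> = x * sqrt x" using assms by (subst powr_add) (simp add: powr_half_sqrt)
  finally show ?thesis using assms by (simp add: power3_eq_cube)
qed

lemma inverse_sqrt_deriv:
  fixes q q' :: "real \<Rightarrow> real"
  assumes "(q has_real_derivative q' t) (at t)" "q t > 0"
  shows "((\<lambda>t. 1 / sqrt (q t)) has_real_derivative - q' t / (2 * sqrt (q t) ^ 3)) (at t)"
  using assms by (auto intro!: derivative_eq_intros simp: field_simps power2_eq_square power3_eq_cube)

text \<open>The bound on \<open>q'\<close> says exactly that the derivative of
  \<open>1 / sqrt q\<close> has absolute value at most 1, so adding or subtracting \<open>t\<close>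
  makes \<open>1 / sqrt (q t)\<close> monotone.\<close>

lemma inverse_sqrt_lipschitz:
  fixes q q' :: "real \<Rightarrow> real"
  assumes deriv: "\<And>t. (q has_real_derivative q' t) (at t)"
    and pos: "\<And>t. q t > 0"
    and sc: "\<And>t. \<bar>q' t\<bar> \<le> 2 * q t powr (3 / 2)"
    and "t \<ge> 0"
  shows "\<bar>1 / sqrt (q t) - 1 / sqrt (q 0)\<bar> \<le> t"
proof -
  let ?s = "\<lambda>t. 1 / sqrt (q t)" and ?s' = "\<lambda>t. - q' t / (2 * sqrt (q t) ^ 3)"
  have d: "(?s has_real_derivative ?s' x) (at x)" for x
    using inverse_sqrt_deriv[of q q' x] deriv pos by blast
  have b: "\<bar>?s' x\<bar> \<le> 1" for x
    using sc[of x] pos[of x] by (simp add: powr_three_halves_sqrt abs_mult)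
  have "?s 0 + 0 \<le> ?s t + t"
  proof (rule deriv_nonneg_imp_mono[where g = "\<lambda>t. ?s t + t"])
    show "((\<lambda>t. ?s t + t) has_real_derivative ?s' x + 1) (at x)" for x
      by (rule DERIV_add[OF d DERIV_ident])
    show "0 \<le> ?s' x + 1" for x using b[of x] by linarith
  qed fact
  moreover have "0 - ?s 0 \<le> t - ?s t"
  proof (rule deriv_nonneg_imp_mono[where g = "\<lambda>t. t - ?s t"])
    show "((\<lambda>t. t - ?s t) has_real_derivative 1 - ?s' x) (at x)" for x
      by (rule DERIV_diff[OF DERIV_ident d])
    show "0 \<le> 1 - ?s' x" for x using b[of x] by linarith
  qed fact
  ultimately show ?thesis by linarith
qed

text \<open>Integrating the inequality twice: the difference of the first derivatives is
  nondecreasing from 0, and then so is the difference of the functions.\<close>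

lemma second_derivative_comparison:
  fixes \<phi> \<psi> :: "real \<Rightarrow> real"
  assumes \<phi>: "\<And>t. t \<in> {0..1} \<Longrightarrow> (\<phi> has_real_derivative \<phi>' t) (at t)"
             "\<And>t. t \<in> {0..1} \<Longrightarrow> (\<phi>' has_real_derivative \<phi>'' t) (at t)"
    and \<psi>: "\<And>t. t \<in> {0..1} \<Longrightarrow> (\<psi> has_real_derivative \<psi>' t) (at t)"
             "\<And>t. t \<in> {0..1} \<Longrightarrow> (\<psi>' has_real_derivative \<psi>'' t) (at t)"
    and init: "\<phi> 0 = \<psi> 0" "\<phi>' 0 = \<psi>' 0"
    and le: "\<And>t. t \<in> {0..1} \<Longrightarrow> \<phi>'' t \<le> \<psi>'' t"
  shows "\<phi> 1 \<le> \<psi> 1"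
proof -
  have 1: "\<phi>' t \<le> \<psi>' t" if "t \<in> {0..1}" for t
  proof -
    have "\<psi>' 0 - \<phi>' 0 \<le> \<psi>' t - \<phi>' t"
      by (rule deriv_nonneg_imp_mono[where g' = "\<lambda>t. \<psi>'' t - \<phi>'' t"])
        (use that \<phi> \<psi> le in \<open>auto intro!: derivative_intros\<close>)
    then show ?thesis using init by simp
  qed
  have "\<psi> 0 - \<phi> 0 \<le> \<psi> 1 - \<phi> 1"
    by (rule deriv_nonneg_imp_mono[where g' = "\<lambda>t. \<psi>' t - \<phi>' t"])
      (use \<phi> \<psi> 1 in \<open>auto intro!: derivative_intros\<close>)
  then show ?thesis using init by simp
qed

context
  fixes \<phi> \<phi>' q q' :: "real \<Rightarrow> real" and r :: real
  assumes deriv: "\<And>t. (\<phi> has_real_derivative \<phi>' t) (at t)"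
      "\<And>t. (\<phi>' has_real_derivative q t) (at t)"
      "\<And>t. (q has_real_derivative q' t) (at t)"
    and pos: "\<And>t. q t > 0"
    and sc: "\<And>t. \<bar>q' t\<bar> \<le> 2 * q t powr (3 / 2)"
  defines "r \<equiv> sqrt (q 0)"
begin

text \<open>The Lipschitz bound \<open>1 / sqrt (q t) <= 1 / r + t\<close> inverts to
  \<open>q t >= (r / (1 + r * t))^2\<close>. The minorant \<open>?p\<close> is the double primitive
  of the right-hand side with the initial data of \<open>\<phi>\<close>.\<close>

lemma self_concordant_line_lower: "\<phi> 0 + \<phi>' 0 + \<omega> r \<le> \<phi> 1"
proof -
  have r: "r > 0" using pos[of 0] by (simp add: r_def)
  let ?p = "\<lambda>t. \<phi> 0 + \<phi>' 0 * t + r * t - ln (1 + r * t)"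
  let ?p' = "\<lambda>t. \<phi>' 0 + r - r / (1 + r * t)"
  let ?p'' = "\<lambda>t. (r / (1 + r * t))\<^sup>2"
  have p: "1 + r * t > 0" if "t \<in> {0..1}" for t using that r by (simp add: add_pos_nonneg)
  have "?p 1 \<le> \<phi> 1"
  proof (rule second_derivative_comparison[where \<phi> = ?p and \<psi> = \<phi> and \<phi>' = ?p' and \<psi>' = \<phi>' and \<phi>'' = ?p'' and \<psi>'' = q])
    fix t :: real assume t: "t \<in> {0..1}"
    note p = p[OF t]
    show "(?p has_real_derivative ?p' t) (at t)"
      using p by (auto intro!: derivative_eq_intros simp: field_simps)
    show "(?p' has_real_derivative ?p'' t) (at t)"
      using p by (auto intro!: derivative_eq_intros simp: field_simps power2_eq_square)
    have "1 / sqrt (q t) \<le> 1 / r + t"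
      using inverse_sqrt_lipschitz[of q q' t] deriv(3) pos sc t by (auto simp: r_def)
    then have "r / (1 + r * t) \<le> sqrt (q t)"
      using p r pos[of t] by (simp add: field_simps)
    then have "(r / (1 + r * t))\<^sup>2 \<le> (sqrt (q t))\<^sup>2"
      using p r by (intro power_mono) auto
    then show "?p'' t \<le> q t" using pos[of t] by simp
  qed (use deriv in auto)
  then show ?thesis by (simp add: \<omega>_def)
qed

text \<open>This is the opposite half of the Lipschitz bound; \<open>r < 1\<close> keeps the
  denominator \<open>1 - r * t\<close> positive on the whole unit interval.\<close>

lemma self_concordant_line_upper:
  assumes "r < 1"
  shows "\<phi> 1 \<le> \<phi> 0 + \<phi>' 0 - r - ln (1 - r)"
proof -
  have r: "r > 0" using pos[of 0] by (simp add: r_def)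
  let ?p = "\<lambda>t. \<phi> 0 + \<phi>' 0 * t - r * t - ln (1 - r * t)"
  let ?p' = "\<lambda>t. \<phi>' 0 - r + r / (1 - r * t)"
  let ?p'' = "\<lambda>t. (r / (1 - r * t))\<^sup>2"
  have p: "1 - r * t > 0" if "t \<in> {0..1}" for t
    using that r assms by (auto intro: le_less_trans[OF mult_left_le])
  have "\<phi> 1 \<le> ?p 1"
  proof (rule second_derivative_comparison[where \<psi> = ?p and \<phi> = \<phi> and \<psi>' = ?p' and \<phi>' = \<phi>' and \<psi>'' = ?p'' and \<phi>'' = q])
    fix t :: real assume t: "t \<in> {0..1}"
    note p = p[OF t]
    show "(?p has_real_derivative ?p' t) (at t)"
      using p by (auto intro!: derivative_eq_intros simp: field_simps)
    show "(?p' has_real_derivative ?p'' t) (at t)"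
      using p by (auto intro!: derivative_eq_intros simp: field_simps power2_eq_square)
    have "1 / r - t \<le> 1 / sqrt (q t)"
      using inverse_sqrt_lipschitz[of q q' t] deriv(3) pos sc t by (auto simp: r_def)
    then have "sqrt (q t) \<le> r / (1 - r * t)"
      using p r pos[of t] by (simp add: field_simps)
    then have "(sqrt (q t))\<^sup>2 \<le> (r / (1 - r * t))\<^sup>2"
      using p r pos[of t] by (intro power_mono) auto
    then show "q t \<le> ?p'' t" using pos[of t] by simp
  qed (use deriv in auto)
  then show ?thesis by simp
qed

end

subsection \<open>Estimates for the function \<open>\<omega>\<close>\<close>

text \<open>Both sides vanish at 0 and their difference has derivative
  \<open>t^2 / (2 * (1 + t)^2)\<close>. The bound later lets \<open>\<omega>\<close> absorb the loss
  caused by the residual.\<close>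

lemma \<omega>_ge:
  assumes "0 \<le> t"
  shows "t\<^sup>2 / (2 * (1 + t)) \<le> \<omega> t"
proof -
  have "\<omega> 0 - 0\<^sup>2 / (2 * (1 + 0)) \<le> \<omega> t - t\<^sup>2 / (2 * (1 + t))"
  proof (rule deriv_nonneg_imp_mono[where g = "\<lambda>t. \<omega> t - t\<^sup>2 / (2 * (1 + t))" and g' = "\<lambda>t. t\<^sup>2 / (2 * (1 + t)\<^sup>2)"])
    fix x :: real assume "x \<in> {0..t}"
    then have x: "0 \<le> x" by simp
    have "((\<lambda>t. \<omega> t - t\<^sup>2 / (2 * (1 + t))) has_real_derivative (1 - 1 / (1 + x))
        - (2 * x * (2 * (1 + x)) - x\<^sup>2 * 2) / (2 * (1 + x) * (2 * (1 + x)))) (at x)"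
      unfolding \<omega>_def using x by (auto intro!: derivative_eq_intros)
    also have "(1 - 1 / (1 + x)) - (2 * x * (2 * (1 + x)) - x\<^sup>2 * 2) / (2 * (1 + x) * (2 * (1 + x)))
        = x\<^sup>2 / (2 * (1 + x)\<^sup>2)"
      using x by (simp add: divide_simps) (simp add: algebra_simps power2_eq_square)
    finally show "((\<lambda>t. \<omega> t - t\<^sup>2 / (2 * (1 + t))) has_real_derivative x\<^sup>2 / (2 * (1 + x)\<^sup>2)) (at x)" .
    show "0 \<le> x\<^sup>2 / (2 * (1 + x)\<^sup>2)" by simp
  qed (use assms in auto)
  then show ?thesis by (simp add: \<omega>_def)
qed

lemma \<omega>_mono:
  assumes "0 \<le> s" "s \<le> t"
  shows "\<omega> s \<le> \<omega> t"
proof (rule deriv_nonneg_imp_mono[where g = \<omega> and g' = "\<lambda>t. t / (1 + t)"])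
  fix x assume "x \<in> {s..t}"
  then have x: "0 \<le> x" using assms by simp
  show "(\<omega> has_real_derivative x / (1 + x)) (at x)"
    unfolding \<omega>_def[abs_def] using x by (auto intro!: derivative_eq_intros simp: divide_simps)
  show "0 \<le> x / (1 + x)" using x by simp
qed (use assms in auto)

text \<open>The difference \<open>?F\<close> vanishes at 0, and its derivative is nonnegative up to
  \<open>1 / 6\<close>. The right-hand side is the guaranteed decrease of a step, the left-hand side
  half of the bound on the gap before it.\<close>

lemma decrement_ge_half_gap_bound:
  fixes d :: real
  assumes "0 \<le> d" "d \<le> 1 / 6"
  shows "(- (20 / 19 * d) - ln (1 - 20 / 19 * d)) / 2 \<le> \<omega> d - d\<^sup>2 / (19 * (1 + d))"
proof -
  let ?F = "\<lambda>d. \<omega> d - d\<^sup>2 / (19 * (1 + d)) - (- (20 / 19 * d) - ln (1 - 20 / 19 * d)) / 2"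
  let ?F' = "\<lambda>d. d * ((17 + 18 * d) * (19 - 20 * d) - 200 * (1 + d)\<^sup>2) / (19 * (1 + d)\<^sup>2 * (19 - 20 * d))"
  have "?F 0 \<le> ?F d"
  proof (rule deriv_nonneg_imp_mono[where g = ?F and g' = ?F'])
    fix x assume "x \<in> {0..d}"
    then have x: "0 \<le> x" "x \<le> 1 / 6" using assms by auto
    have "(?F has_real_derivative (1 - 1 / (1 + x))
        - (2 * x * (19 * (1 + x)) - x\<^sup>2 * 19) / (19 * (1 + x) * (19 * (1 + x)))
        - (- (20 / 19) + 20 / 19 / (1 - 20 / 19 * x)) / 2) (at x)"
      unfolding \<omega>_def using x by (auto intro!: derivative_eq_intros)
    also have "(1 - 1 / (1 + x)) = x / (1 + x)" using x by (simp add: field_simps)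
    also have "(2 * x * (19 * (1 + x)) - x\<^sup>2 * 19) / (19 * (1 + x) * (19 * (1 + x)))
        = x * (2 + x) / (19 * (1 + x)\<^sup>2)"
      using x by (simp add: divide_simps) (simp add: algebra_simps power2_eq_square)
    also have "(- (20 / 19) + 20 / 19 / (1 - 20 / 19 * x)) / 2 = 200 * x / (19 * (19 - 20 * x))"
      using x by (simp add: divide_simps)
    also have "x / (1 + x) - x * (2 + x) / (19 * (1 + x)\<^sup>2) - 200 * x / (19 * (19 - 20 * x)) = ?F' x"
      using x by (simp add: divide_simps) (simp add: algebra_simps power2_eq_square)
    finally show "(?F has_real_derivative ?F' x) (at x)" .
    \<comment> \<open>The sign-determining factor expands to
      \<open>123 - 398 * x - 560 * x * x\<close>, which exceeds 41 for \<open>x\<close> in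
      \<open>[0, 1/6]\<close>.\<close>
    have "x * x \<le> 1/6 * 1/6" using x mult_mono[of x "1/6" x "1/6"] by simp
    then have "0 \<le> (17 + 18 * x) * (19 - 20 * x) - 200 * (1 + x)\<^sup>2"
      using x by (simp add: algebra_simps power2_eq_square)
    then show "0 \<le> ?F' x" using x by (intro divide_nonneg_nonneg mult_nonneg_nonneg) auto
  qed (use assms in auto)
  then show ?thesis by (simp add: \<omega>_def)
qed

subsection \<open>Gradient, Hessian and third derivative\<close>

text \<open>The Riesz representative of the derivative is \<open>adjoint f' 1\<close>. Its
  uniqueness is what makes the \<open>THE\<close> in \<open>grad\<close> denote it.\<close>

lemma grad_has_derivative:
  fixes f :: "real ^ 'd \<Rightarrow> real"
  assumes "f differentiable (at x)"
  shows "(f has_derivative (\<lambda>h. h \<bullet> grad f x)) (at x)"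
proof -
  obtain f' where f': "(f has_derivative f') (at x)" using assms by (auto simp: differentiable_def)
  have "f' h = h \<bullet> adjoint f' 1" for h
    using adjoint_works[OF has_derivative_linear[OF f'], of h 1] by simp
  then have "f' = (\<lambda>h. h \<bullet> adjoint f' 1)" by blast
  then have ex: "GDERIV f x :> adjoint f' 1"
    using f' by (simp add: gderiv_def)
  have "g = adjoint f' 1" if "GDERIV f x :> g" for g
  proof -
    have "(\<lambda>h. h \<bullet> g) = (\<lambda>h. h \<bullet> adjoint f' 1)"
      using that ex has_derivative_unique unfolding gderiv_def by blast
    then have "\<forall>h. h \<bullet> g = h \<bullet> adjoint f' 1" by metis
    then show ?thesis by (simp add: vector_eq_ldot)
  qed
  then have "GDERIV f x :> grad f x"
    unfolding grad_def using ex by (metis theI)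
  then show ?thesis by (simp add: gderiv_def)
qed

lemma has_derivative_along_line:
  fixes F :: "'a::real_normed_vector \<Rightarrow> 'b::real_normed_vector"
  assumes "(F has_derivative F') (at (x + t *\<^sub>R u))"
  shows "((\<lambda>t. F (x + t *\<^sub>R u)) has_derivative (\<lambda>k. F' (k *\<^sub>R u))) (at t)"
proof -
  have "((\<lambda>t. x + t *\<^sub>R u) has_derivative (\<lambda>k. k *\<^sub>R u)) (at t)"
    using has_derivative_add[OF has_derivative_const has_derivative_scaleR_left[OF has_derivative_ident], of x u "at t"]
    by simp
  then show ?thesis by (rule has_derivative_compose[where f = "\<lambda>t. x + t *\<^sub>R u" and g = F, OF _ assms])
qed

text \<open>Differentiability of the Hessian makes the difference quotient \<open>Q\<close>
  converge, so the \<open>Lim\<close> in \<open>third_deriv\<close> is a genuine limit and equals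
  the directional derivative \<open>A\<close>.\<close>

lemma third_deriv_has_vector_derivative:
  fixes f :: "real ^ 'd \<Rightarrow> real"
  assumes "hessian f differentiable (at x)"
  shows "((\<lambda>t. hessian f (x + t *\<^sub>R u)) has_vector_derivative third_deriv f x u) (at 0)"
proof -
  define A where "A = frechet_derivative (hessian f) (at x) u"
  have D: "(hessian f has_derivative frechet_derivative (hessian f) (at x)) (at (x + 0 *\<^sub>R u))"
    using iffD1[OF frechet_derivative_works assms] by (simp only: scaleR_zero_left add_0_right)
  have "((\<lambda>t. hessian f (x + t *\<^sub>R u)) has_derivative (\<lambda>t. frechet_derivative (hessian f) (at x) (t *\<^sub>R u))) (at 0)"
    by (rule has_derivative_along_line[OF D])
  moreover have "frechet_derivative (hessian f) (at x) (t *\<^sub>R u) = t *\<^sub>R A" for t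
    unfolding A_def by (rule linear_cmul[OF linear_frechet_derivative[OF assms]])
  ultimately have A: "((\<lambda>t. hessian f (x + t *\<^sub>R u)) has_derivative (\<lambda>t. t *\<^sub>R A)) (at 0)"
    by (simp only:)
  define Q where "Q t = (1 / t) *\<^sub>R (hessian f (x + t *\<^sub>R u) - hessian f x)" for t
  define N where "N t = norm (hessian f (x + t *\<^sub>R u) - hessian f x - t *\<^sub>R A) / norm t" for t
  have "N \<midarrow>0\<rightarrow> 0"
    using A unfolding N_def by (simp add: has_derivative_at)
  moreover have "N t = norm (Q t - A)" if "t \<noteq> 0" for t
  proof -
    have "Q t - A = (1 / t) *\<^sub>R (hessian f (x + t *\<^sub>R u) - hessian f x - t *\<^sub>R A)"
      using that by (simp add: Q_def scaleR_diff_right)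
    then show ?thesis by (simp add: N_def)
  qed
  then have "\<forall>\<^sub>F t in at 0. N t = norm (Q t - A)"
    by (rule eventually_mono[OF eventually_neq_at_within])
  ultimately have "(\<lambda>t. norm (Q t - A)) \<midarrow>0\<rightarrow> 0"
    by (simp add: tendsto_cong)
  then have "Q \<midarrow>0\<rightarrow> A"
    by (rule LIM_zero_cancel[OF tendsto_norm_zero_cancel])
  then have "third_deriv f x u = A"
    unfolding third_deriv_def Q_def[abs_def, symmetric] by (intro tendsto_Lim) auto
  then show ?thesis using A by (simp add: has_vector_derivative_def)
qed

section \<open>Symmetry of the second derivative\<close>

text \<open>The mean value theorem in direction \<open>u\<close> turns the second difference into a
  difference of two values of \<open>G\<close>; expanding both to first order at \<open>x\<close>
  leaves \<open>t * H v\<close> plus remainders of order o(t).\<close>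

lemma mixed_difference_estimate:
  fixes f :: "'a::euclidean_space \<Rightarrow> real"
  assumes G: "\<And>x. (f has_derivative (\<lambda>h. h \<bullet> G x)) (at x)"
    and H: "(G has_derivative H) (at x)"
    and "e > 0"
  shows "\<forall>\<^sub>F t in at_right 0.
    \<bar>f (x + t *\<^sub>R u + t *\<^sub>R v) - f (x + t *\<^sub>R u) - f (x + t *\<^sub>R v) + f x - t\<^sup>2 * (u \<bullet> H v)\<bar> \<le> e * t\<^sup>2"
proof -
  \<comment> \<open>Chosen so that the two remainders, with tolerance \<open>e / C\<close>, add up
    to \<open>e * t * ((C - 1) / C)\<close>; the summand 1 keeps \<open>C\<close> positive when
    \<open>u = 0\<close>.\<close>
  define C where "C = norm u * (2 * norm u + norm v) + 1"
  have C: "C > 0" unfolding C_def by (intro add_nonneg_pos mult_nonneg_nonneg add_nonneg_nonneg) auto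
  interpret H: bounded_linear H using H by (rule has_derivative_bounded_linear)
  obtain d where d: "d > 0" "\<And>y. norm (y - x) < d \<Longrightarrow> norm (G y - G x - H (y - x)) \<le> e / C * norm (y - x)"
    using H \<open>e > 0\<close> C unfolding has_derivative_at_alt by (meson divide_pos_pos)
  have "\<bar>f (x + t *\<^sub>R u + t *\<^sub>R v) - f (x + t *\<^sub>R u) - f (x + t *\<^sub>R v) + f x - t\<^sup>2 * (u \<bullet> H v)\<bar> \<le> e * t\<^sup>2"
    if t: "t > 0" "t * (norm u + norm v) < d" for t
  proof -
    let ?h = "\<lambda>s. f (x + s *\<^sub>R u + t *\<^sub>R v) - f (x + s *\<^sub>R u)"
    have der: "(?h has_real_derivative u \<bullet> G (x + s *\<^sub>R u + t *\<^sub>R v) - u \<bullet> G (x + s *\<^sub>R u)) (at s)" for s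
    proof -
      have "((\<lambda>s. f (x + s *\<^sub>R u + c)) has_derivative (\<lambda>k. (k *\<^sub>R u) \<bullet> G (x + s *\<^sub>R u + c))) (at s)" for c
        using has_derivative_along_line[where F = f and x = "x + c" and t = s and u = u, OF G] by (simp add: add_ac)
      from this[of "t *\<^sub>R v"] this[of 0]
      show ?thesis
        unfolding has_field_derivative_def
        by (auto intro!: derivative_eq_intros simp: algebra_simps)
    qed
    obtain s where s: "0 < s" "s < t"
      and mv: "?h t - ?h 0 = (t - 0) * (u \<bullet> G (x + s *\<^sub>R u + t *\<^sub>R v) - u \<bullet> G (x + s *\<^sub>R u))"
      using MVT2[OF t(1), of ?h, OF der] by blast
    define R where "R y = G y - G x - H (y - x)" for y
    have n1: "norm ((x + s *\<^sub>R u + t *\<^sub>R v) - x) \<le> t * (norm u + norm v)"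
    proof -
      have "norm (s *\<^sub>R u + t *\<^sub>R v) \<le> s * norm u + t * norm v"
        using norm_triangle_ineq[of "s *\<^sub>R u" "t *\<^sub>R v"] s t by simp
      also have "\<dots> \<le> t * norm u + t * norm v" using s by (simp add: mult_right_mono)
      finally show ?thesis by (simp add: algebra_simps)
    qed
    have n2: "norm ((x + s *\<^sub>R u) - x) \<le> t * norm u"
      using s by (simp add: mult_right_mono)
    have n2': "t * norm u \<le> t * (norm u + norm v)" using t by simp
    have R1: "norm (R (x + s *\<^sub>R u + t *\<^sub>R v)) \<le> e / C * (t * (norm u + norm v))"
      unfolding R_def using d(2)[of "x + s *\<^sub>R u + t *\<^sub>R v"] n1 t(2) C \<open>e > 0\<close>
      by (smt (verit) divide_pos_pos mult_left_mono)
    have R2: "norm (R (x + s *\<^sub>R u)) \<le> e / C * (t * norm u)"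
      unfolding R_def using d(2)[of "x + s *\<^sub>R u"] n2 n2' t(2) C \<open>e > 0\<close>
      by (smt (verit) divide_pos_pos mult_left_mono)
    have "G (x + s *\<^sub>R u + t *\<^sub>R v) - G (x + s *\<^sub>R u)
        = t *\<^sub>R H v + (R (x + s *\<^sub>R u + t *\<^sub>R v) - R (x + s *\<^sub>R u))"
      by (simp add: R_def H.add H.scaleR H.diff)
    then have "u \<bullet> G (x + s *\<^sub>R u + t *\<^sub>R v) - u \<bullet> G (x + s *\<^sub>R u)
        = t * (u \<bullet> H v) + u \<bullet> (R (x + s *\<^sub>R u + t *\<^sub>R v) - R (x + s *\<^sub>R u))"
      by (metis inner_add_right inner_diff_right inner_scaleR_right)
    then have "?h t - ?h 0 - t\<^sup>2 * (u \<bullet> H v)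
        = t * (u \<bullet> (R (x + s *\<^sub>R u + t *\<^sub>R v) - R (x + s *\<^sub>R u)))"
      by (simp only: mv) (simp add: algebra_simps power2_eq_square)
    moreover have "\<bar>u \<bullet> (R (x + s *\<^sub>R u + t *\<^sub>R v) - R (x + s *\<^sub>R u))\<bar> \<le> e * t"
    proof -
      have "\<bar>u \<bullet> (R (x + s *\<^sub>R u + t *\<^sub>R v) - R (x + s *\<^sub>R u))\<bar>
          \<le> norm u * norm (R (x + s *\<^sub>R u + t *\<^sub>R v) - R (x + s *\<^sub>R u))"
        by (rule Cauchy_Schwarz_ineq2)
      also have "\<dots> \<le> norm u * (e / C * (t * (norm u + norm v)) + e / C * (t * norm u))"
        by (intro mult_left_mono norm_triangle_le_diff add_mono R1 R2) auto
      also have "\<dots> = e * t * ((C - 1) / C)"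
        by (simp add: C_def algebra_simps add_divide_distrib)
      also have "\<dots> \<le> e * t * 1"
        using C \<open>e > 0\<close> t by (intro mult_left_mono) (auto simp: field_simps)
      finally show ?thesis by simp
    qed
    ultimately have "\<bar>?h t - ?h 0 - t\<^sup>2 * (u \<bullet> H v)\<bar> \<le> t * (e * t)"
      using t by (simp add: abs_mult)
    then show ?thesis by (simp add: algebra_simps power2_eq_square)
  qed
  moreover have "\<forall>\<^sub>F t in at_right 0. t * (norm u + norm v) < d"
  proof -
    have "((\<lambda>t. t * (norm u + norm v)) \<longlongrightarrow> 0 * (norm u + norm v)) (at_right 0)"
      by (intro tendsto_intros)
    then show ?thesis using d(1) by (intro order_tendstoD(2)) auto
  qed
  moreover have "\<forall>\<^sub>F t in at_right (0::real). t > 0" by (simp add: eventually_at_right_less)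
  ultimately show ?thesis by (auto elim: eventually_elim2)
qed

text \<open>The mixed second difference is unchanged when \<open>u\<close> and \<open>v\<close> are
  swapped, so its two quadratic approximations differ by at most \<open>e * t^2\<close> for small
  \<open>t\<close>. Dividing by \<open>t^2\<close> leaves an arbitrary \<open>e\<close>.\<close>

lemma symmetric_second_derivative:
  fixes f :: "'a::euclidean_space \<Rightarrow> real"
  assumes G: "\<And>x. (f has_derivative (\<lambda>h. h \<bullet> G x)) (at x)"
    and H: "(G has_derivative H) (at x)"
  shows "u \<bullet> H v = v \<bullet> H u"
proof -
  have "\<bar>u \<bullet> H v - v \<bullet> H u\<bar> \<le> 0 + e" if "e > 0" for e
  proof -
    have "e / 2 > 0" using that by simp
    have "\<forall>\<^sub>F t in at_right (0::real). t > 0" by (simp add: eventually_at_right_less)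
    with mixed_difference_estimate[OF G H \<open>e / 2 > 0\<close>, of u v]
      mixed_difference_estimate[OF G H \<open>e / 2 > 0\<close>, of v u]
    have "\<forall>\<^sub>F t in at_right (0::real). \<bar>u \<bullet> H v - v \<bullet> H u\<bar> \<le> e"
    proof eventually_elim
      case (elim t)
      have "x + t *\<^sub>R v + t *\<^sub>R u = x + t *\<^sub>R u + t *\<^sub>R v" by simp
      note vu = elim(2)[unfolded this]
      have "e * t\<^sup>2 = e / 2 * t\<^sup>2 + e / 2 * t\<^sup>2" by simp
      with elim(1) vu have "\<bar>t\<^sup>2 * (u \<bullet> H v) - t\<^sup>2 * (v \<bullet> H u)\<bar> \<le> e * t\<^sup>2" by linarith
      also have "t\<^sup>2 * (u \<bullet> H v) - t\<^sup>2 * (v \<bullet> H u) = (u \<bullet> H v - v \<bullet> H u) * t\<^sup>2" by (simp add: algebra_simps)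
      finally show ?case using elim by (simp add: abs_mult)
    qed
    then show ?thesis using eventually_happens'[OF trivial_limit_at_right_real] by simp
  qed
  then have "\<bar>u \<bullet> H v - v \<bullet> H u\<bar> \<le> 0" by (rule field_le_epsilon)
  then show ?thesis by simp
qed

lemma Cauchy_Schwarz_matrix:
  fixes A :: "real ^ 'n ^ 'n"
  assumes sym: "\<And>a b. a \<bullet> (A *v b) = b \<bullet> (A *v a)"
    and pos: "\<And>a. a \<noteq> 0 \<Longrightarrow> 0 < a \<bullet> (A *v a)"
  shows "\<bar>a \<bullet> (A *v b)\<bar> \<le> sqrt (a \<bullet> (A *v a)) * sqrt (b \<bullet> (A *v b))"
proof (cases "b = 0")
  case False
  \<comment> \<open>The value of \<open>t\<close> minimising the quadratic form at
    \<open>a - t *\<^sub>R b\<close>.\<close>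
  define t where "t = a \<bullet> (A *v b) / (b \<bullet> (A *v b))"
  note b = pos[OF False]
  have "0 \<le> (a - t *\<^sub>R b) \<bullet> (A *v (a - t *\<^sub>R b))"
    using pos[of "a - t *\<^sub>R b"] by (cases "a - t *\<^sub>R b = 0") auto
  also have "\<dots> = a \<bullet> (A *v a) - 2 * t * (a \<bullet> (A *v b)) + t * t * (b \<bullet> (A *v b))"
    using sym[of b a]
    by (simp add: matrix_vector_mult_diff_distrib matrix_vector_mult_scaleR inner_diff_left inner_diff_right algebra_simps)
  also have "\<dots> = a \<bullet> (A *v a) - (a \<bullet> (A *v b))\<^sup>2 / (b \<bullet> (A *v b))"
    using b by (simp add: t_def power2_eq_square)
  finally have "(a \<bullet> (A *v b))\<^sup>2 \<le> a \<bullet> (A *v a) * (b \<bullet> (A *v b))"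
    using b by (simp add: field_simps)
  then have "sqrt ((a \<bullet> (A *v b))\<^sup>2) \<le> sqrt (a \<bullet> (A *v a) * (b \<bullet> (A *v b)))"
    by (rule real_sqrt_le_mono)
  then show ?thesis by (simp add: real_sqrt_mult)
qed simp

subsection \<open>The inexact Newton step\<close>

locale self_concordant_bounded =
  fixes f :: "real ^ 'd \<Rightarrow> real" and lam L :: real
  assumes sc: "standard_self_concordant f"
    and lam: "0 < lam" and lam_le: "lam \<le> L"
    and lower: "\<And>x. loewner_le (lam *\<^sub>R mat 1) (hessian f x)"
    and upper: "\<And>x. loewner_le (hessian f x) (L *\<^sub>R mat 1)"
begin

lemma grad_deriv: "(f has_derivative (\<lambda>h. h \<bullet> grad f x)) (at x)"
  using sc by (intro grad_has_derivative) (simp add: standard_self_concordant_def C3_def)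

lemma hessian_deriv: "(grad f has_derivative (\<lambda>h. hessian f x *v h)) (at x)"
  using sc jacobian_works[of "grad f" "at x"]
  by (simp add: standard_self_concordant_def C3_def hessian_def)

lemma hessian_symmetric: "u \<bullet> (hessian f x *v v) = v \<bullet> (hessian f x *v u)"
  by (rule symmetric_second_derivative[OF grad_deriv hessian_deriv])

lemma hessian_ge: "lam * (norm u)\<^sup>2 \<le> u \<bullet> (hessian f x *v u)"
  using lower[of x] unfolding loewner_le_def
  by (simp add: matrix_vector_mult_diff_rdistrib inner_diff_right power2_norm_eq_inner
      flip: scaleR_matrix_vector_assoc)

lemma hessian_le: "u \<bullet> (hessian f x *v u) \<le> L * (norm u)\<^sup>2"
  using upper[of x] unfolding loewner_le_def
  by (simp add: matrix_vector_mult_diff_rdistrib inner_diff_right power2_norm_eq_inner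
      flip: scaleR_matrix_vector_assoc)

lemma hessian_pos: "u \<noteq> 0 \<Longrightarrow> 0 < u \<bullet> (hessian f x *v u)"
  using hessian_ge[of u x] lam by (smt (verit) mult_pos_pos zero_less_norm_iff zero_less_power)

abbreviation local_norm :: "real ^ 'd \<Rightarrow> real ^ 'd \<Rightarrow> real" where
  "local_norm x u \<equiv> sqrt (u \<bullet> (hessian f x *v u))"

lemma local_norm_nonneg: "0 \<le> local_norm x u"
  using hessian_pos[of u x] by (cases "u = 0") auto

lemma local_norm_scaleR: "local_norm x (c *\<^sub>R u) = \<bar>c\<bar> * local_norm x u"
  by (simp add: matrix_vector_mult_scaleR real_sqrt_mult)

lemma norm_le_local_norm: "sqrt lam * norm u \<le> local_norm x u"
  using real_sqrt_le_mono[OF hessian_ge[of u x]] by (simp add: real_sqrt_mult)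

lemma hessian_Cauchy_Schwarz: "\<bar>u \<bullet> (hessian f x *v v)\<bar> \<le> local_norm x u * local_norm x v"
  by (rule Cauchy_Schwarz_matrix[OF hessian_symmetric hessian_pos])

text \<open>Pairing \<open>hessian f x *v v\<close> with itself, the local Cauchy-Schwarz inequality
  and the upper Hessian bound produce one factor of its Euclidean norm on each side, which
  cancels.\<close>

lemma norm_hessian_le: "norm (hessian f x *v v) \<le> sqrt L * local_norm x v"
proof (cases "hessian f x *v v = 0")
  case True
  then show ?thesis using lam lam_le by simp
next
  case False
  let ?y = "hessian f x *v v"
  have "norm ?y * norm ?y = ?y \<bullet> ?y" by (simp add: power2_norm_eq_inner flip: power2_eq_square)
  also have "\<dots> \<le> local_norm x ?y * local_norm x v"
    using hessian_Cauchy_Schwarz[of ?y x v] by linarith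
  also have "local_norm x ?y \<le> sqrt L * norm ?y"
    using real_sqrt_le_mono[OF hessian_le[of ?y x]] by (simp add: real_sqrt_mult)
  then have "local_norm x ?y * local_norm x v \<le> sqrt L * norm ?y * local_norm x v"
    by (rule mult_right_mono) (rule local_norm_nonneg)
  finally show ?thesis using False by simp
qed

section \<open>Self-concordance bounds along lines\<close>

lemma line_derivs:
  shows "((\<lambda>t. f (x + t *\<^sub>R u)) has_real_derivative u \<bullet> grad f (x + t *\<^sub>R u)) (at t)"
    and "((\<lambda>t. u \<bullet> grad f (x + t *\<^sub>R u)) has_real_derivative u \<bullet> (hessian f (x + t *\<^sub>R u) *v u)) (at t)"
    and "((\<lambda>t. u \<bullet> (hessian f (x + t *\<^sub>R u) *v u)) has_real_derivative
      u \<bullet> (third_deriv f (x + t *\<^sub>R u) u *v u)) (at t)"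
proof -
  show "((\<lambda>t. f (x + t *\<^sub>R u)) has_real_derivative u \<bullet> grad f (x + t *\<^sub>R u)) (at t)"
    using has_derivative_along_line[OF grad_deriv]
    by (simp add: has_field_derivative_def mult_commute_abs)
  have "((\<lambda>t. u \<bullet> grad f (x + t *\<^sub>R u)) has_derivative (\<lambda>k. u \<bullet> (hessian f (x + t *\<^sub>R u) *v (k *\<^sub>R u)))) (at t)"
    by (intro has_derivative_inner_right has_derivative_along_line[OF hessian_deriv])
  then show "((\<lambda>t. u \<bullet> grad f (x + t *\<^sub>R u)) has_real_derivative u \<bullet> (hessian f (x + t *\<^sub>R u) *v u)) (at t)"
    by (simp add: has_field_derivative_def matrix_vector_mult_scaleR mult_commute_abs)
  have "bounded_linear (\<lambda>M :: real ^ 'd ^ 'd. u \<bullet> (M *v u))"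
    by (auto intro!: linearI simp: linear_conv_bounded_linear[symmetric] matrix_vector_mult_add_rdistrib inner_add_right
        simp flip: scaleR_matrix_vector_assoc)
  \<comment> \<open>The derivative is first taken at parameter 0 of the line based at
    \<open>x + t *\<^sub>R u\<close>, as in \<open>third_deriv\<close>, and then shifted to
    \<open>t\<close>.\<close>
  moreover have "((\<lambda>s. hessian f (x + t *\<^sub>R u + s *\<^sub>R u)) has_vector_derivative third_deriv f (x + t *\<^sub>R u) u) (at 0)"
    using sc by (intro third_deriv_has_vector_derivative) (simp add: standard_self_concordant_def C3_def)
  ultimately have "((\<lambda>s. u \<bullet> (hessian f (x + t *\<^sub>R u + s *\<^sub>R u) *v u)) has_vector_derivative
      u \<bullet> (third_deriv f (x + t *\<^sub>R u) u *v u)) (at 0)"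
    by (rule bounded_linear.has_vector_derivative)
  then have "((\<lambda>s. u \<bullet> (hessian f (x + (s + t) *\<^sub>R u) *v u)) has_real_derivative
      u \<bullet> (third_deriv f (x + t *\<^sub>R u) u *v u)) (at 0)"
    by (simp add: has_real_derivative_iff_has_vector_derivative algebra_simps)
  then show "((\<lambda>t. u \<bullet> (hessian f (x + t *\<^sub>R u) *v u)) has_real_derivative
      u \<bullet> (third_deriv f (x + t *\<^sub>R u) u *v u)) (at t)"
    using DERIV_shift[where f = "\<lambda>t. u \<bullet> (hessian f (x + t *\<^sub>R u) *v u)" and x = 0 and z = t] by simp
qed

text \<open>The one-variable bound is applied to the restriction of \<open>f\<close> to the segment
  from \<open>x\<close> to \<open>x + u\<close>. It requires a positive second derivative, hence the
  separate case \<open>u = 0\<close>.\<close>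

lemma self_concordant_lower:
  "f x + u \<bullet> grad f x + \<omega> (local_norm x u) \<le> f (x + u)"
proof (cases "u = 0")
  case True
  then show ?thesis by (simp add: \<omega>_def)
next
  case False
  have "\<bar>u \<bullet> (third_deriv f z u *v u)\<bar> \<le> 2 * (u \<bullet> (hessian f z *v u)) powr (3 / 2)" for z
    using sc by (simp add: standard_self_concordant_def)
  from self_concordant_line_lower[OF line_derivs(1,2,3)[where u = u and x = x] hessian_pos[OF False] this]
  show ?thesis by simp
qed

lemma self_concordant_upper:
  assumes "local_norm x u < 1"
  shows "f (x + u) \<le> f x + u \<bullet> grad f x - local_norm x u - ln (1 - local_norm x u)"
proof (cases "u = 0")
  case False
  have "\<bar>u \<bullet> (third_deriv f z u *v u)\<bar> \<le> 2 * (u \<bullet> (hessian f z *v u)) powr (3 / 2)" for z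
    using sc by (simp add: standard_self_concordant_def)
  from self_concordant_line_upper[OF line_derivs(1,2,3)[where u = u and x = x] hessian_pos[OF False] this] assms
  show ?thesis by simp
qed simp

section \<open>One step with a relative residual\<close>

context
  fixes x v :: "real ^ 'd" and \<delta> :: real
  assumes residual: "norm (hessian f x *v v - grad f x) \<le> 1 / 20 * sqrt (lam / L) * norm (grad f x)"
  defines "\<delta> \<equiv> local_norm x v"
begin

lemma delta_nonneg: "0 \<le> \<delta>"
  unfolding \<delta>_def by (rule local_norm_nonneg)

text \<open>The factor \<open>sqrt (lam / L)\<close> in the tolerance pays for both changes of norm:
  \<open>sqrt L\<close> bounds the gradient through \<open>\<delta>\<close>, and
  \<open>sqrt lam\<close> passes from \<open>norm h\<close> to the local norm.\<close>

lemma residual_inner_le: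
  "\<bar>h \<bullet> (hessian f x *v v - grad f x)\<bar> \<le> 1 / 19 * \<delta> * local_norm x h"
proof -
  let ?r = "hessian f x *v v - grad f x" and ?g = "grad f x"
  have L: "0 < L" using lam lam_le by simp
  have "sqrt (lam / L) \<le> 1" using lam lam_le by simp
  then have "1 / 20 * sqrt (lam / L) * norm ?g \<le> 1 / 20 * 1 * norm ?g"
    by (intro mult_right_mono mult_left_mono) auto
  then have "norm ?r \<le> 1 / 20 * norm ?g" using residual by linarith
  moreover have "norm ?g \<le> norm (hessian f x *v v) + norm ?r"
    using norm_triangle_ineq4[of "hessian f x *v v" ?r] by simp
  \<comment> \<open>The residual is at most a twentieth of the gradient, so the gradient is at most
    \<open>20 / 19\<close> times \<open>hessian f x *v v\<close> in norm. Multiplied by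
    \<open>1 / 20\<close> this gives the constant \<open>1 / 19\<close>.\<close>
  ultimately have g: "norm ?g \<le> 20 / 19 * (sqrt L * \<delta>)"
    using norm_hessian_le[of x v] by (simp add: \<delta>_def)
  have "\<bar>h \<bullet> ?r\<bar> \<le> norm h * norm ?r" by (rule Cauchy_Schwarz_ineq2)
  also have "\<dots> \<le> norm h * (1 / 20 * sqrt (lam / L) * (20 / 19 * (sqrt L * \<delta>)))"
    by (intro mult_left_mono order_trans[OF residual] g) (use lam L in auto)
  also have "\<dots> = 1 / 19 * \<delta> * (sqrt lam * norm h)"
    using L by (simp add: real_sqrt_divide)
  also have "\<dots> \<le> 1 / 19 * \<delta> * local_norm x h"
    by (intro mult_left_mono norm_le_local_norm) (use delta_nonneg in auto)
  finally show ?thesis .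
qed

text \<open>Damping gives the step local length \<open>\<delta> / (1 + \<delta>) < 1\<close>, so the
  upper bound always applies. An exact direction would yield the decrease
  \<open>\<omega> \<delta>\<close>; the residual lowers \<open>v \<bullet> grad f x\<close> from
  \<open>\<delta>^2\<close> to no less than \<open>18 / 19 * \<delta>^2\<close>.\<close>

lemma newton_step_decrease:
  "f (x - (1 / (1 + \<delta>)) *\<^sub>R v) \<le> f x - (\<omega> \<delta> - \<delta>\<^sup>2 / (19 * (1 + \<delta>)))"
proof -
  let ?c = "1 / (1 + \<delta>)"
  have d: "0 \<le> \<delta>" by (rule delta_nonneg)
  have n: "local_norm x ((- ?c) *\<^sub>R v) = \<delta> / (1 + \<delta>)"
    unfolding local_norm_scaleR using d by (simp add: \<delta>_def)
  have "v \<bullet> (hessian f x *v v) = \<delta>\<^sup>2"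
    using local_norm_nonneg[where u = v and x = x] by (simp add: \<delta>_def)
  then have g: "18 / 19 * \<delta>\<^sup>2 \<le> v \<bullet> grad f x"
    using residual_inner_le[of v, folded \<delta>_def] unfolding inner_diff_right power2_eq_square
    by linarith
  have "ln (1 - \<delta> / (1 + \<delta>)) = ln (inverse (1 + \<delta>))"
    using d by (intro arg_cong[where f = ln]) (simp add: field_simps)
  then have ln: "ln (1 - \<delta> / (1 + \<delta>)) = - ln (1 + \<delta>)"
    using d by (simp add: ln_inverse)
  have "f (x - ?c *\<^sub>R v) \<le> f x - v \<bullet> grad f x / (1 + \<delta>) - \<delta> / (1 + \<delta>) + ln (1 + \<delta>)"
    using self_concordant_upper[where x = x and u = "(- ?c) *\<^sub>R v", unfolded n ln] d by simp
  also have "\<dots> \<le> f x - 18 / 19 * \<delta>\<^sup>2 / (1 + \<delta>) - \<delta> / (1 + \<delta>) + ln (1 + \<delta>)"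
    using divide_right_mono[OF g, of "1 + \<delta>"] d by simp
  also have "\<dots> = f x - (\<omega> \<delta> - \<delta>\<^sup>2 / (19 * (1 + \<delta>)))"
    using d unfolding \<omega>_def by (simp add: divide_simps) (simp add: algebra_simps power2_eq_square)
  finally show ?thesis .
qed

text \<open>The slope from \<open>x\<close> towards \<open>y\<close> is at least
  \<open>- l * \<rho>\<close>, where \<open>l\<close> is \<open>\<delta>\<close> plus the residual
  share \<open>\<delta> / 19\<close>. Maximising \<open>l * \<rho> - \<omega> \<rho>\<close> over
  \<open>\<rho>\<close> amounts to \<open>ln z <= z - 1\<close> at
  \<open>z = (1 + \<rho>) * (1 - l)\<close>.\<close>

lemma gap_le_delta:
  assumes "20 / 19 * \<delta> < 1"
  shows "f x - f y \<le> - (20 / 19 * \<delta>) - ln (1 - 20 / 19 * \<delta>)"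
proof -
  define \<rho> where "\<rho> = local_norm x (y - x)"
  define l where "l = 20 / 19 * \<delta>"
  have \<rho>: "0 \<le> \<rho>" unfolding \<rho>_def by (rule local_norm_nonneg)
  have l: "l < 1" using assms by (simp add: l_def)
  have "- (l * \<rho>) \<le> (y - x) \<bullet> grad f x"
  proof -
    have "\<bar>(y - x) \<bullet> (hessian f x *v v - grad f x)\<bar> \<le> 1 / 19 * \<delta> * \<rho>"
      unfolding \<rho>_def by (rule residual_inner_le)
    moreover have "\<bar>(y - x) \<bullet> (hessian f x *v v)\<bar> \<le> \<rho> * \<delta>"
      unfolding \<rho>_def \<delta>_def by (rule hessian_Cauchy_Schwarz)
    moreover have "l * \<rho> = 1 / 19 * \<delta> * \<rho> + \<rho> * \<delta>" by (simp add: l_def)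
    ultimately show ?thesis unfolding inner_diff_right by linarith
  qed
  then have "f x - f y \<le> l * \<rho> - \<omega> \<rho>"
    using self_concordant_lower[of x "y - x"] by (simp flip: \<rho>_def)
  \<comment> \<open>the conjugacy inequality \<open>l \<rho> - \<omega>(\<rho>) \<le> \<omega>\<^sub>*(l)\<close>\<close>
  moreover have "ln ((1 + \<rho>) * (1 - l)) \<le> (1 + \<rho>) * (1 - l) - 1"
    using \<rho> l by (intro ln_le_minus_one mult_pos_pos) auto
  moreover have "ln ((1 + \<rho>) * (1 - l)) = ln (1 + \<rho>) + ln (1 - l)"
    using \<rho> l by (intro ln_mult_pos) auto
  ultimately show ?thesis unfolding l_def[symmetric] by (simp add: \<omega>_def algebra_simps)
qed

text \<open>The maximum merges the regimes of large and small \<open>\<delta>\<close>, so the later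
  recursion involves the gap alone and never mentions \<open>\<delta>\<close>.\<close>

lemma newton_step_gap:
  fixes y\<^sub>0 :: "real ^ 'd"
  defines "gap \<equiv> \<lambda>z. f z - f y\<^sub>0"
  shows "gap (x - (1 / (1 + \<delta>)) *\<^sub>R v) \<le> max (gap x - \<omega> (1 / 6) / 2) (gap x / 2)"
proof (cases "\<delta> \<le> 1 / 6")
  case True
  then have "gap x \<le> - (20 / 19 * \<delta>) - ln (1 - 20 / 19 * \<delta>)"
    unfolding gap_def by (intro gap_le_delta) simp
  then show ?thesis
    using newton_step_decrease decrement_ge_half_gap_bound[OF delta_nonneg True]
    unfolding gap_def by argo
next
  case False
  have "\<omega> (1 / 6) \<le> \<omega> \<delta>" using False by (intro \<omega>_mono) auto
  \<comment> \<open>With 19 weakened to 4, the residual loss is half of the lower bound in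
    \<open>\<omega>_ge\<close>; at least half of \<open>\<omega> \<delta>\<close> survives.\<close>
  moreover have "\<delta>\<^sup>2 / (19 * (1 + \<delta>)) \<le> \<omega> \<delta> / 2"
  proof -
    have "\<delta>\<^sup>2 / (19 * (1 + \<delta>)) \<le> \<delta>\<^sup>2 / (4 * (1 + \<delta>))"
      using delta_nonneg by (intro divide_left_mono) auto
    also have "\<dots> = \<delta>\<^sup>2 / (2 * (1 + \<delta>)) / 2" by simp
    also have "\<dots> \<le> \<omega> \<delta> / 2" by (intro divide_right_mono \<omega>_ge delta_nonneg) auto
    finally show ?thesis .
  qed
  ultimately have "f (x - (1 / (1 + \<delta>)) *\<^sub>R v) \<le> f x - \<omega> (1 / 6) / 2"
    using newton_step_decrease by linarith
  then show ?thesis by (simp add: gap_def)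
qed

end

end

section \<open>Iteration count\<close>

text \<open>Above level \<open>2 * c\<close> both alternatives lower the sequence by at least \<open>c\<close>; below it both
  at least halve it.\<close>

lemma two_phase_decrease:
  fixes g :: "nat \<Rightarrow> real"
  assumes c: "c > 0"
    and step: "\<And>j. g (Suc j) \<le> max (g j - c) (g j / 2)"
    and start: "g 0 \<le> real n * c"
  shows "g (n + m) \<le> 2 * c / 2 ^ m"
proof -
  \<comment> \<open>The cap \<open>2 * c\<close> persists once reached, so the time of the switch
    need not be located; at \<open>j = n\<close> the linear term is at most 0.\<close>
  have "g j \<le> max (2 * c) (g 0 - real j * c)" for j
  proof (induction j)
    case (Suc j)
    then show ?case using step[of j] c by (auto simp: max_def algebra_simps split: if_splits)
  qed simp
  from this[of n] have n: "g n \<le> 2 * c" using start c by simp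
  show ?thesis
  proof (induction m)
    case (Suc m)
    have "2 * c / 2 ^ m \<le> 2 * c / 1" using c by (intro divide_left_mono) auto
    then have "g (n + m) \<le> 2 * c" using Suc by simp
    then have "g (Suc (n + m)) \<le> g (n + m) / 2" using step[of "n + m"] by simp
    then show ?case using Suc by simp
  qed (use n in simp)
qed

theorem corollary1:
  fixes f :: "real ^ 'd \<Rightarrow> real"
    and L lam \<beta> \<epsilon> :: real
    and w\<^sub>s :: "real ^ 'd"
    and w :: "nat \<Rightarrow> real ^ 'd"
    and k :: nat
  assumes "standard_self_concordant f"
    and "0 < lam" and "lam \<le> L"
    and "\<And>x. loewner_le (lam *\<^sub>R mat 1) (hessian f x)"
    and "\<And>x. loewner_le (hessian f x) (L *\<^sub>R mat 1)"
    and "\<And>x. f w\<^sub>s \<le> f x"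
    and "\<beta> = 1 / 20"
    and "inexact_damped_newton f (\<lambda>j. \<beta> * sqrt (lam / L) * norm (grad f (w j))) w"
    and "0 < \<epsilon>"
    and "k \<ge> nonneg_ceiling ((f (w 0) - f w\<^sub>s) / (1 / 2 * \<omega> (1 / 6)))
             + nonneg_ceiling (log 2 (2 * \<omega> (1 / 6) / \<epsilon>))"
  shows "f (w k) - f w\<^sub>s \<le> \<epsilon>"
proof -
  interpret self_concordant_bounded f lam L
    using assms by unfold_locales auto
  define g where "g j = f (w j) - f w\<^sub>s" for j
  define n where "n = nonneg_ceiling (g 0 / (1 / 2 * \<omega> (1 / 6)))"
  \<comment> \<open>The iterations left for the halving phase; the subtraction is exact because
    \<open>k\<close> is at least \<open>n\<close>.\<close>
  define m where "m = k - n"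
  have k: "k = n + m" and m: "nonneg_ceiling (log 2 (2 * \<omega> (1 / 6) / \<epsilon>)) \<le> m"
    using assms(10) by (auto simp: n_def m_def g_def)
  have pos: "0 < \<omega> (1 / 6)" 
    by (rule less_le_trans[OF _ \<omega>_ge]) (simp_all add: power2_eq_square)
  obtain v where v: "\<And>j. norm (hessian f (w j) *v v j - grad f (w j)) \<le> 1 / 20 * sqrt (lam / L) * norm (grad f (w j))"
      "\<And>j. w (Suc j) = w j - (1 / (1 + local_norm (w j) (v j))) *\<^sub>R v j"
    using assms(7,8) unfolding inexact_damped_newton_def Let_def by blast
  have "g (Suc j) \<le> max (g j - \<omega> (1 / 6) / 2) (g j / 2)" for j
    using newton_step_gap[OF v(1), of j w\<^sub>s] by (simp add: g_def v(2))
  moreover have "g 0 \<le> real n * (\<omega> (1 / 6) / 2)"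
    using pos real_nat_ceiling_ge[of "g 0 / (1 / 2 * \<omega> (1 / 6))"]
    unfolding n_def nonneg_ceiling_eq by (simp add: field_simps)
  \<comment> \<open>Here \<open>c = \<omega> (1 / 6) / 2\<close>, so halving starts from the level
    \<open>\<omega> (1 / 6)\<close>. The logarithm in \<open>m\<close> brings the result down to at
    most \<open>\<epsilon> / 2\<close>.\<close>
  ultimately have "g (n + m) \<le> 2 * (\<omega> (1 / 6) / 2) / 2 ^ m"
    using pos by (intro two_phase_decrease) auto
  also have "\<dots> \<le> \<epsilon>"
  proof -
    have "log 2 (2 * \<omega> (1 / 6) / \<epsilon>) \<le> real m"
      using m real_nat_ceiling_ge[of "log 2 (2 * \<omega> (1 / 6) / \<epsilon>)"]
      unfolding nonneg_ceiling_eq by linarith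
    then have "2 * \<omega> (1 / 6) / \<epsilon> \<le> 2 powr real m"
      using pos assms(9) by (simp add: log_le_iff)
    then show ?thesis using pos assms(9) by (simp add: powr_realpow field_simps)
  qed
  finally show ?thesis by (simp add: g_def k)
qed

end
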